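(* Let $w_1,\dots,w_n$ ($n\geqslant 1$) be pairwise different nonempty words over an alphabet $\Sigma$ which do not all commute pairwise (that is, $w_iw_j\neq w_jw_i$ for some $i,j$), and let $k>1$ be an integer. Then $\mathrm{Var}(w_1^*+\ldots+w_n^* )=k$ if and only if the set $\{w_1,\dots,w_n\}$ is divided into exactly $k-1$ equivalence classes with respect to the relation $\sim_c$.
   Context: Alphabets are finite. $w^*=\{w^m : m\geqslant 0\}$ (with $w^0=\varepsilon$ the empty word), and $+$ denotes union of languages, so $w_1^*+\ldots+w_n^*=\bigcup_{i=1}^n\{w_i^m : m\geqslant 0\}$. A context-free grammar (CFG) is a tuple $(N,\Sigma,P,S)$ with finite set of nonterminals $N$, terminal alphabet $\Sigma$, finite set $P$ of productions $A\to\alpha$ with $A\in N$, $\alpha\in(N\cup\Sigma)^*$ (productions $A\to\varepsilon$ are allowed), and start symbol $S\in N$. For a context-free language $L$, its nonterminal complexity is $\mathrm{Var}(L)=\min\{|N| : L \text{ is generated by a CFG } (N,\Sigma,P,S)\}$. A nonempty word is primitive if it is not of the form $v^m$ with $v$ a word and $m\geqslant 2$. For every nonempty word $u$, $\widehat{u}$ denotes the unique primitive word such that $u=\widehat{u}^m$ for some integer $m\geqslant 1$. For nonempty words $x,y$, write $x\sim_c y$ if there exist words $z,w$ (possibly empty) such that $\widehat{x}=zw$ and $\widehat{y}=wz$; this is an equivalence relation. *)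

theory Defs
  imports Main
begin

definition wpow :: "'a list \<Rightarrow> nat \<Rightarrow> 'a list" where
  "wpow w m = concat (replicate m w)"

definition wstar :: "'a list \<Rightarrow> 'a list set" where
  "wstar w = range (wpow w)"

definition primitive :: "'a list \<Rightarrow> bool" where
  "primitive u \<longleftrightarrow> u \<noteq> [] \<and> \<not> (\<exists>v m. 2 \<le> m \<and> u = wpow v m)"

text \<open>Only meaningful for nonempty words; there it is well defined by \<open>ex1_root\<close> below.\<close>

definition root :: "'a list \<Rightarrow> 'a list" where
  "root u = (THE p. primitive p \<and> (\<exists>m\<ge>1. u = wpow p m))"

definition conj_rel :: "('a list \<times> 'a list) set" where
  "conj_rel = {(x, y). x \<noteq> [] \<and> y \<noteq> [] \<and> (\<exists>z v. root x = z @ v \<and> root y = v @ z)}"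

lemma wpow_0 [simp]: "wpow w 0 = []"
  and wpow_Suc: "wpow w (Suc m) = w @ wpow w m"
  by (simp_all add: wpow_def)

lemma wpow_add: "wpow w (m + n) = wpow w m @ wpow w n"
  by (simp add: wpow_def replicate_add)

lemma wpow_mult: "wpow (wpow w m) n = wpow w (m * n)"
  by (induction n) (simp_all add: wpow_Suc wpow_add)

lemma length_wpow: "length (wpow w m) = m * length w"
  by (induction m) (simp_all add: wpow_Suc)

lemma wpow_comm: "w @ wpow w m = wpow w m @ w"
  using wpow_add[of w 1 m] wpow_add[of w m 1] by (simp add: wpow_Suc)

lemma ex_root: "u \<noteq> [] \<Longrightarrow> \<exists>p. primitive p \<and> (\<exists>m\<ge>1. u = wpow p m)"
proof (induction u rule: length_induct)
  case (1 u)
  show ?case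
  proof (cases "primitive u")
    case True
    moreover have "u = wpow u 1" by (simp add: wpow_def)
    ultimately show ?thesis by blast
  next
    case False
    then obtain v m where m: "2 \<le> m" and u: "u = wpow v m"
      using 1 by (auto simp: primitive_def)
    have v: "v \<noteq> []" using 1 u by (auto simp: wpow_def)
    have "length u = m * length v" by (simp add: u length_wpow)
    with v m have "length v < length u" by simp
    with 1 v obtain p n where "primitive p" "1 \<le> n" "v = wpow p n" by blast
    with u m show ?thesis by (intro exI[of _ p] conjI exI[of _ "n * m"]) (auto simp: wpow_mult)
  qed
qed

lemma root_unique:
  assumes p: "primitive p" and q: "primitive q"
    and m: "1 \<le> m" and n: "1 \<le> n" and eq: "wpow p m = wpow q n"
  shows "p = q"
proof -
  define W where "W = wpow p m"
  have pW: "p @ W = W @ p" by (simp add: W_def wpow_comm)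
  have qW: "q @ W = W @ q" by (simp add: W_def eq wpow_comm)
  have "length p \<le> length W" using m by (simp add: W_def length_wpow)
  moreover have "length q \<le> length W" using n by (simp add: W_def eq length_wpow)
  ultimately have len: "length p + length q \<le> length (W @ W)" by simp
  have 1: "(p @ q) @ (W @ W) = (W @ W) @ (p @ q)"
    and 2: "(q @ p) @ (W @ W) = (W @ W) @ (q @ p)"
    using pW qW by (metis append.assoc)+
  have "p @ q = take (length p + length q) (W @ W)"
    using arg_cong[OF 1, of "take (length p + length q)"] len by simp
  moreover have "q @ p = take (length p + length q) (W @ W)"
    using arg_cong[OF 2, of "take (length p + length q)"] len by simp
  ultimately have "p @ q = q @ p" by simp
  from comm_append_are_replicate[OF this]
  obtain a b z where a: "p = wpow z a" and b: "q = wpow z b"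
    by (auto simp: wpow_def)
  have one: "c = 1" if "primitive (wpow z c)" for c
  proof -
    have "c \<noteq> 0" "\<not> 2 \<le> c" using that unfolding primitive_def by (auto intro: gr0I)
    then show ?thesis by linarith
  qed
  have "a = 1" "b = 1" using one p q a b by blast+
  then show ?thesis by (simp only: a b)
qed

lemma ex1_root:
  assumes "u \<noteq> []"
  shows "\<exists>!p. primitive p \<and> (\<exists>m\<ge>1. u = wpow p m)"
  using ex_root[OF assms] root_unique by blast

lemma equiv_conj_rel: "equiv {x. x \<noteq> []} conj_rel"
proof -
  have *: "(\<exists>z v. x = z @ v \<and> y = v @ z) \<longleftrightarrow> (\<exists>n. y = rotate n x)" for x y :: "'b list"
    by (metis append_take_drop_id rotate_append rotate_drop_take)
  show ?thesis
  proof (rule equivI)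
    show "conj_rel \<subseteq> {x. x \<noteq> []} \<times> {x. x \<noteq> []}" by (auto simp: conj_rel_def)
    show "refl_on {x. x \<noteq> []} conj_rel"
      by (auto simp: refl_on_def conj_rel_def)
    show "sym conj_rel" by (auto simp: sym_def conj_rel_def)
    show "trans conj_rel" unfolding trans_def conj_rel_def *
      by (auto simp: rotate_rotate)
  qed
qed

text \<open>The sum type keeps nonterminals and terminals disjoint.\<close>

record ('n, 't) cfg =
  nonterminals :: "'n set"
  terminals :: "'t set"
  productions :: "('n \<times> ('n + 't) list) set"
  start :: 'n

definition is_cfg :: "('n, 't) cfg \<Rightarrow> bool" where
  "is_cfg G \<longleftrightarrow>
     finite (nonterminals G) \<and> finite (terminals G) \<and> finite (productions G) \<and>
     start G \<in> nonterminals G \<and>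
     productions G \<subseteq> nonterminals G \<times> lists (nonterminals G <+> terminals G)"

definition derives1 :: "('n, 't) cfg \<Rightarrow> ('n + 't) list \<Rightarrow> ('n + 't) list \<Rightarrow> bool" where
  "derives1 G x y \<longleftrightarrow>
     (\<exists>u v A \<alpha>. (A, \<alpha>) \<in> productions G \<and> x = u @ [Inl A] @ v \<and> y = u @ \<alpha> @ v)"

definition language :: "('n, 't) cfg \<Rightarrow> 't list set" where
  "language G = {w. (derives1 G)\<^sup>*\<^sup>* [Inl (start G)] (map Inr w)}"

text \<open>Since nonterminal sets are finite, taking nonterminals from \<^typ>\<open>nat\<close> is no restriction:
  any grammar can be renamed. For a language that is not context-free the value is irrelevant.\<close>

definition Var :: "'t list set \<Rightarrow> nat" where
  "Var L = (LEAST k. \<exists>G :: (nat, 't) cfg. is_cfg G \<and> language G = L \<and> card (nonterminals G) = k)"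

end

theory Submission
  imports Defs "HOL-Library.Sublist"
begin

text \<open>Upper bound: one nonterminal per conjugacy class generates the powers of a single word
  \<open>P\<close> (a high power of the common root). A suitable power of each \<open>w\<close> in the class is a rotation of
  \<open>P\<close>, so \<open>w\<^sup>*\<close> is obtained from finitely many start productions that add a prefix and a suffix.

  Lower bound: every class owns a nonterminal \<open>A\<close> with \<open>A \<Rightarrow>\<^sup>+ u A v\<close>, where \<open>u\<close> or \<open>v\<close> is
  conjugate to a power of the root of the class. Iterating two such loops at the same \<open>A\<close> puts high
  powers from both into one word of the language, so \<open>A\<close> determines the class. The start symbol is
  not among these nonterminals: pumping it around \<open>w\<^sup>a\<close> for all the words \<open>w\<close> forces them to have
  the same root, that is, to commute.\<close>

section \<open>Powers, roots and conjugacy\<close>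

lemma root_props:
  assumes "u \<noteq> []"
  shows primitive_root: "primitive (root u)" and ex_wpow_root: "\<exists>m\<ge>1. u = wpow (root u) m"
  using theI'[OF ex1_root[OF assms]] unfolding root_def by blast+

lemma root_eqI:
  assumes "primitive p" "m \<ge> 1" "u = wpow p m"
  shows "root u = p"
proof -
  have "u \<noteq> []"
    using assms by (cases m) (auto simp: wpow_Suc primitive_def)
  then show ?thesis
    using ex_wpow_root primitive_root root_unique assms by metis
qed

lemma wpow_eq_Nil_iff [simp]: "wpow w m = [] \<longleftrightarrow> w = [] \<or> m = 0"
  by (cases m) (auto simp: wpow_def)

lemma root_wpow:
  assumes "u \<noteq> []" "m \<ge> 1"
  shows "root (wpow u m) = root u"
proof -
  obtain k where "k \<ge> 1" "u = wpow (root u) k"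
    using ex_wpow_root[OF assms(1)] by blast
  then have "wpow u m = wpow (root u) (k * m)"
    by (metis wpow_mult)
  then show ?thesis
    using assms \<open>k \<ge> 1\<close> primitive_root by (intro root_eqI[of _ "k * m"]) auto
qed

text \<open>Commuting words are powers of one common word, and a power has the root of its base.
  This lets non-commutation enter the lower bound as a statement about roots.\<close>

lemma commute_iff_root_eq:
  assumes "x \<noteq> []" "y \<noteq> []"
  shows "x @ y = y @ x \<longleftrightarrow> root x = root y"
proof
  assume "x @ y = y @ x"
  from comm_append_are_replicate[OF this]
  obtain a b z where x: "x = wpow z a" and y: "y = wpow z b"
    by (auto simp: wpow_def)
  have "z \<noteq> []" "a \<ge> 1" "b \<ge> 1"
    using assms x y by (auto simp: Suc_le_eq)
  then show "root x = root y"
    using x y by (simp add: root_wpow)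
next
  assume eq: "root x = root y"
  obtain a b where "x = wpow (root x) a" "y = wpow (root x) b"
    using assms ex_wpow_root eq by metis
  then show "x @ y = y @ x"
    by (metis wpow_add add.commute)
qed

text \<open>For a single letter \<open>x\<close> this moves \<open>rotate1\<close> inside a power;
  in the grammar it turns \<open>v @ wpow (z @ v) j @ z\<close> into
  \<open>wpow (v @ z) (Suc j)\<close>.\<close>

lemma wpow_slide: "wpow (x @ y) m @ x = x @ wpow (y @ x) m"
  by (induction m) (simp_all add: wpow_Suc)

lemma rotate_wpow: "rotate n (wpow w m) = wpow (rotate n w) m"
proof (induction n)
  case (Suc n)
  have "rotate1 (wpow v m) = wpow (rotate1 v) m" for v :: "'a list"
  proof (cases v)
    case (Cons a q)
    show ?thesis
      using wpow_slide[of "[a]" q] by (cases m) (simp_all add: Cons wpow_Suc)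
  qed (simp add: wpow_def)
  with Suc show ?case by simp
qed simp

lemma rotate_inverse: "\<exists>k. rotate k (rotate n w) = w"
proof (cases "w = []")
  case False
  have "rotate (length w - n mod length w) (rotate (n mod length w) w) = w"
    using False by (simp add: rotate_rotate less_imp_le)
  then show ?thesis by (metis rotate_conv_mod)
qed simp

lemma primitive_rotate:
  assumes "primitive p"
  shows "primitive (rotate n p)"
proof -
  have False if "2 \<le> m" "rotate n p = wpow v m" for v m
  proof -
    obtain k where "rotate k (rotate n p) = p"
      using rotate_inverse by blast
    then have "p = wpow (rotate k v) m"
      using that rotate_wpow by metis
    then show False
      using assms that by (auto simp: primitive_def)
  qed
  then show ?thesis
    using assms by (auto simp: primitive_def)
qed

lemma root_rotate:
  assumes "u \<noteq> []"
  shows "root (rotate n u) = rotate n (root u)"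
proof -
  obtain k where "k \<ge> 1" "u = wpow (root u) k"
    using ex_wpow_root[OF assms] by blast
  then show ?thesis
    using primitive_rotate[OF primitive_root[OF assms]] rotate_wpow root_eqI by metis
qed

lemma conj_rel_iff_rotate:
  "(x, y) \<in> conj_rel \<longleftrightarrow> x \<noteq> [] \<and> y \<noteq> [] \<and> (\<exists>n. root y = rotate n (root x))"
proof -
  have "(\<exists>z v. p = z @ v \<and> q = v @ z) \<longleftrightarrow> (\<exists>n. q = rotate n p)" for p q :: "'a list"
    by (metis append_take_drop_id rotate_append rotate_drop_take)
  then show ?thesis
    by (simp add: conj_rel_def)
qed

lemma conj_rel_sym: "(x, y) \<in> conj_rel \<Longrightarrow> (y, x) \<in> conj_rel"
  using equiv_conj_rel by (auto simp: equiv_def dest: symD)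

lemma conj_rel_trans: "(x, y) \<in> conj_rel \<Longrightarrow> (y, z) \<in> conj_rel \<Longrightarrow> (x, z) \<in> conj_rel"
  using equiv_conj_rel by (auto simp: equiv_def dest: transD)

section \<open>Long common factors of powers\<close>

lemma take_prefix_wpow:
  assumes "prefix x (wpow w m)" "j * length w \<le> length x" "w \<noteq> []"
  shows "take (j * length w) x = wpow w j"
proof -
  have "length x \<le> m * length w"
    using prefix_length_le[OF assms(1)] by (simp add: length_wpow)
  then have "j \<le> m"
    using assms(2,3) by (metis le_trans length_0_conv mult_le_cancel2 not_gr_zero)
  then have "take (j * length w) (wpow w m) = wpow w j"
    using wpow_add[of w j "m - j"] by (simp add: length_wpow)
  then show ?thesis
    using assms(1,2) by (auto simp: prefix_def)
qed

text \<open>A weak form of the Fine-Wilf theorem: the prefix of \<open>x\<close> of length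
  \<open>length w * length v\<close> is at once a power of \<open>w\<close> and a power of
  \<open>v\<close>.\<close>

lemma root_eq_if_common_prefix:
  assumes "prefix x (wpow w m)" "prefix x (wpow v k)" "w \<noteq> []" "v \<noteq> []"
    and "length w * length v \<le> length x"
  shows "root w = root v"
proof -
  have "wpow w (length v) = wpow v (length w)"
    using take_prefix_wpow[of x w m "length v"] take_prefix_wpow[of x v k "length w"] assms
    by (simp add: mult.commute)
  moreover have "length v \<ge> 1" "length w \<ge> 1"
    using assms by (auto simp: Suc_le_eq)
  ultimately show ?thesis
    using root_wpow assms by metis
qed

text \<open>Rotating the power past the letters before the occurrence brings \<open>x\<close> to the
  front, and a rotated power is a power of the rotated base.\<close>

lemma prefix_if_sublist_wpow:
  assumes "sublist x (wpow w m)"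
  shows "\<exists>n. prefix x (wpow (rotate n w) m)"
proof -
  obtain p s where "wpow w m = p @ x @ s"
    using assms by (auto simp: sublist_def)
  then have "wpow (rotate (length p) w) m = x @ s @ p"
    using rotate_wpow[of "length p" w m] rotate_append[of p "x @ s"] by simp
  then show ?thesis by (metis prefixI)
qed

lemma conj_rel_if_common_sublist:
  assumes "sublist x (wpow w m)" "sublist x (wpow v k)" "w \<noteq> []" "v \<noteq> []"
    and "length w * length v \<le> length x"
  shows "(w, v) \<in> conj_rel"
proof -
  obtain i j where ij: "prefix x (wpow (rotate i w) m)" "prefix x (wpow (rotate j v) k)"
    using prefix_if_sublist_wpow assms by metis
  have "root (rotate i w) = root (rotate j v)"
    using root_eq_if_common_prefix[OF ij] assms by simp
  then have eq: "rotate i (root w) = rotate j (root v)"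
    using assms by (simp add: root_rotate)
  obtain l where "rotate l (rotate j (root v)) = root v"
    using rotate_inverse by blast
  then have "root v = rotate (l + i) (root w)"
    using eq by (metis rotate_rotate)
  then show ?thesis
    using assms conj_rel_iff_rotate by blast
qed

text \<open>Here \<open>wpow u a\<close> is itself the common factor;
  \<open>length v \<le> a\<close> makes it as long as the product of the two lengths.\<close>

lemma conj_rel_if_sublist_wpow:
  assumes "sublist (wpow u a) (wpow v k)" "u \<noteq> []" "v \<noteq> []" "length v \<le> a"
  shows "(u, v) \<in> conj_rel"
  using conj_rel_if_common_sublist[of "wpow u a" u a v k] assms
  by (simp add: length_wpow mult.commute mult_le_mono1)

text \<open>A power of \<open>u\<close> at the very start fixes the phase: \<open>u\<close> and
  \<open>v\<close> have the same root \<open>q\<close>, and removing the leading powers of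
  \<open>q\<close> leaves a power of \<open>q\<close> that begins with \<open>wpow w a\<close>.
  Hence equal roots and not mere conjugacy.\<close>

lemma root_eq_if_pumped_left:
  assumes eq: "wpow u a @ wpow w a @ z = wpow v t"
    and ne: "u \<noteq> []" "w \<noteq> []" "v \<noteq> []" and a: "length v \<le> a"
  shows "root w = root u"
proof -
  have uv: "root u = root v"
    using root_eq_if_common_prefix[of "wpow u a" u a v t] assms
    by (metis length_wpow mult.commute mult_le_mono1 prefixI prefix_order.refl)
  define q where "q = root u"
  have q: "q \<noteq> []" "primitive q"
    using primitive_root[OF ne(1)] by (auto simp: q_def primitive_def)
  obtain i where i: "i \<ge> 1" "u = wpow q i"
    using ex_wpow_root ne q_def by metis
  obtain j where j: "j \<ge> 1" "v = wpow q j"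
    using ex_wpow_root ne q_def uv by metis
  have eq': "wpow q (i * a) @ wpow w a @ z = wpow q (j * t)"
    using eq i j by (simp add: wpow_mult)
  from arg_cong[OF this, of length] have "i * a * length q \<le> j * t * length q"
    by (metis le_add1 length_append length_wpow)
  then have le: "i * a \<le> j * t" using q by simp
  have "wpow w a @ z = wpow q (j * t - i * a)"
    using eq' wpow_add[of q "i * a" "j * t - i * a"] le by simp
  moreover have "length q \<le> a"
    using a j by (cases j) (auto simp: length_wpow)
  ultimately have "root w = root q"
    using root_eq_if_common_prefix[of "wpow w a" w a q "j * t - i * a"] ne q
    by (metis length_wpow mult.commute mult_le_mono1 prefixI prefix_order.refl)
  moreover have "root q = q"
    using q by (intro root_eqI[of _ 1]) (auto simp: wpow_def)
  ultimately show ?thesis by (simp add: q_def)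
qed

lemma rev_wpow: "rev (wpow w m) = wpow (rev w) m"
proof (induction m)
  case (Suc m)
  then show ?case by (metis wpow_Suc rev_append wpow_comm)
qed simp

lemma root_eq_if_pumped_right:
  assumes eq: "z @ wpow w a @ wpow u a = wpow v t"
    and ne: "u \<noteq> []" "w \<noteq> []" "v \<noteq> []" and a: "length v \<le> a"
  shows "root w = root u"
proof -
  have "wpow (rev u) a @ wpow (rev w) a @ rev z = wpow (rev v) t"
    using arg_cong[OF eq, of rev] by (simp add: rev_wpow)
  then have "root (rev w) = root (rev u)"
    by (rule root_eq_if_pumped_left) (use ne a in auto)
  \<comment> \<open>Commutation is the link between roots of reversed words and roots of the words,
    since reversal visibly preserves it.\<close>
  then have "rev w @ rev u = rev u @ rev w"
    using ne by (subst commute_iff_root_eq) auto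
  then have "u @ w = w @ u"
    by (metis rev_append rev_rev_ident)
  then show ?thesis
    using ne commute_iff_root_eq by metis
qed

section \<open>Derivations\<close>

abbreviation derives :: "('n, 't) cfg \<Rightarrow> ('n + 't) list \<Rightarrow> ('n + 't) list \<Rightarrow> bool" where
  "derives G \<equiv> (derives1 G)\<^sup>*\<^sup>*"

lemma derives_context: "derives G x y \<Longrightarrow> derives G (u @ x @ v) (u @ y @ v)"
proof (induction rule: rtranclp_induct)
  case (step y z)
  obtain p q A \<alpha> where "(A, \<alpha>) \<in> productions G" "y = p @ [Inl A] @ q" "z = p @ \<alpha> @ q"
    using step.hyps(2) by (auto simp: derives1_def)
  then have "derives1 G (u @ y @ v) (u @ z @ v)"
    unfolding derives1_def
    by (intro exI[of _ "u @ p"] exI[of _ "q @ v"] exI[of _ A] exI[of _ \<alpha>]) simp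
  with step.IH show ?case by (rule rtranclp.rtrancl_into_rtrancl)
qed simp

lemma derives_in_context:
  assumes "derives G s (u @ x @ v)" "derives G x y"
  shows "derives G s (u @ y @ v)"
  using assms(1) derives_context[OF assms(2), of u v] by (rule rtranclp_trans)

lemma derives_production: "(A, \<alpha>) \<in> productions G \<Longrightarrow> derives G [Inl A] \<alpha>"
  by (rule r_into_rtranclp) (force simp: derives1_def)

abbreviation reaches :: "('n, 't) cfg \<Rightarrow> 'n \<Rightarrow> 't list \<Rightarrow> 'n \<Rightarrow> 't list \<Rightarrow> bool" where
  "reaches G A u B v \<equiv> derives G [Inl A] (map Inr u @ [Inl B] @ map Inr v)"

lemma reaches_trans:
  assumes "reaches G A u B v" "reaches G B x C y"
  shows "reaches G A (u @ x) C (y @ v)"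
  using derives_in_context[OF assms] by simp

lemma reaches_derives:
  assumes "reaches G A u B v" "derives G [Inl B] (map Inr z)"
  shows "derives G [Inl A] (map Inr (u @ z @ v))"
  using derives_in_context[OF assms] by simp

lemma reaches_wpow:
  assumes "reaches G A u A v"
  shows "reaches G A (wpow u a) A (wpow v a)"
proof (induction a)
  case (Suc a)
  from reaches_trans[OF assms this] show ?case
    by (simp add: wpow_Suc wpow_comm)
qed simp

text \<open>Derivation trees with a terminal frontier in which no nonterminal of \<open>M\<close> is
  expanded. The case \<open>M = {}\<close> covers ordinary derivations; the lower bound inducts by
  enlarging \<open>M\<close>.\<close>

inductive yields :: "('n, 't) cfg \<Rightarrow> 'n set \<Rightarrow> ('n + 't) list \<Rightarrow> 't list \<Rightarrow> bool"
  for G M where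
  yields_Nil: "yields G M [] []"
| yields_Inr: "yields G M \<gamma> z \<Longrightarrow> yields G M (Inr a # \<gamma>) (a # z)"
| yields_Inl: "A \<notin> M \<Longrightarrow> (A, \<alpha>) \<in> productions G \<Longrightarrow> yields G M \<alpha> x \<Longrightarrow> yields G M \<gamma> z \<Longrightarrow>
    yields G M (Inl A # \<gamma>) (x @ z)"

inductive_cases yields_InrE: "yields G M (Inr a # \<gamma>) z"
inductive_cases yields_InlE: "yields G M (Inl A # \<gamma>) z"

lemma yields_derives: "yields G M \<gamma> z \<Longrightarrow> derives G \<gamma> (map Inr z)"
proof (induction rule: yields.induct)
  case (yields_Inr \<gamma> z a)
  from derives_context[OF yields_Inr.IH, of "[Inr a]" "[]"] show ?case by simp
next
  case (yields_Inl A \<alpha> x \<gamma> z)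
  have "derives G (Inl A # \<gamma>) (map Inr x @ \<gamma>)"
    using derives_in_context[of G _ "[]", OF _ yields_Inl.IH(1)]
      derives_context[OF derives_production[OF yields_Inl.hyps(2)], of "[]" \<gamma>] by simp
  from derives_in_context[of G _ _ _ "[]", simplified, OF this yields_Inl.IH(2)]
  show ?case by simp
qed simp

lemma yields_append:
  "yields G M \<beta> x \<Longrightarrow> yields G M \<gamma> z \<Longrightarrow> yields G M (\<beta> @ \<gamma>) (x @ z)"
  by (induction rule: yields.induct) (auto intro: yields.intros)

lemma yields_appendD:
  "yields G M (\<beta> @ \<gamma>) z \<Longrightarrow> \<exists>x y. z = x @ y \<and> yields G M \<beta> x \<and> yields G M \<gamma> y"
proof (induction \<beta> arbitrary: z)
  case Nil
  then show ?case by (auto intro: yields_Nil)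
next
  case (Cons X \<beta>)
  show ?case
  proof (cases X)
    case (Inl A)
    with Cons.prems obtain \<alpha> x y where *: "A \<notin> M" "(A, \<alpha>) \<in> productions G" "yields G M \<alpha> x"
      "z = x @ y" "yields G M (\<beta> @ \<gamma>) y"
      by (auto elim: yields_InlE)
    from Cons.IH[OF this(5)] obtain p q where "y = p @ q" "yields G M \<beta> p" "yields G M \<gamma> q"
      by blast
    with * Inl show ?thesis
      by (intro exI[of _ "x @ p"] exI[of _ q]) (auto intro: yields_Inl)
  next
    case (Inr a)
    with Cons.prems obtain y where *: "z = a # y" "yields G M (\<beta> @ \<gamma>) y"
      by (auto elim: yields_InrE)
    from Cons.IH[OF this(2)] obtain p q where "y = p @ q" "yields G M \<beta> p" "yields G M \<gamma> q"
      by blast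
    with * Inr show ?thesis
      by (intro exI[of _ "a # p"] exI[of _ q]) (auto intro: yields_Inr)
  qed
qed

lemma yields_map_Inr: "yields G M (map Inr z) z"
  by (induction z) (auto intro: yields.intros)

text \<open>Induction from the terminal end: undoing one production groups the piece derived from
  its right-hand side under a new tree node.\<close>

lemma derives_yields:
  assumes "derives G \<gamma> (map Inr z)"
  shows "yields G {} \<gamma> z"
  using assms
proof (induction rule: converse_rtranclp_induct)
  case base
  show ?case by (rule yields_map_Inr)
next
  case (step \<beta> \<gamma>)
  obtain u v A \<alpha> where p: "(A, \<alpha>) \<in> productions G" "\<beta> = u @ [Inl A] @ v" "\<gamma> = u @ \<alpha> @ v"
    using step.hyps(1) by (auto simp: derives1_def)
  with step.IH obtain x y t where z: "z = x @ y @ t" and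
    "yields G {} u x" "yields G {} \<alpha> y" "yields G {} v t"
    by (metis yields_appendD)
  with p show ?case
    by (auto intro!: yields_append yields_Inl)
qed

text \<open>Cutting a derivation at an occurrence of \<open>A\<close> with no further \<open>A\<close> below it.\<close>

lemma yields_last_occurrence:
  assumes "yields G M \<gamma> z"
  shows "yields G (insert A M) \<gamma> z \<or>
    (\<exists>x y z' \<alpha>. derives G \<gamma> (map Inr x @ [Inl A] @ map Inr y) \<and> (A, \<alpha>) \<in> productions G \<and>
      yields G (insert A M) \<alpha> z' \<and> z = x @ z' @ y)" (is "_ \<or> ?cut \<gamma> z")
  using assms
proof (induction rule: yields.induct)
  case yields_Nil
  show ?case by (auto intro: yields.intros)
next
  case (yields_Inr \<gamma> z a)
  from yields_Inr.IH show ?case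
  proof
    assume "yields G (insert A M) \<gamma> z"
    then show ?thesis by (auto intro: yields.intros)
  next
    assume "?cut \<gamma> z"
    then obtain x y z' \<alpha> where *: "derives G \<gamma> (map Inr x @ [Inl A] @ map Inr y)"
      "(A, \<alpha>) \<in> productions G" "yields G (insert A M) \<alpha> z'" "z = x @ z' @ y" by blast
    have "derives G (Inr a # \<gamma>) (map Inr (a # x) @ [Inl A] @ map Inr y)"
      using derives_context[OF *(1), of "[Inr a]" "[]"] by simp
    moreover have "a # z = (a # x) @ z' @ y"
      using * by simp
    ultimately show ?thesis
      using *(2,3) by blast
  qed
next
  case (yields_Inl B \<beta> z1 \<gamma> z2)
  \<comment> \<open>Each of the partial derivations \<open>B1\<close>, \<open>B2\<close>,
    \<open>B3\<close> completes everything except the part in which the cut is then made.\<close>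
  have B: "derives G (Inl B # \<gamma>) (\<beta> @ \<gamma>)"
    using derives_context[OF derives_production[OF yields_Inl.hyps(2)], of "[]" \<gamma>] by simp
  have B1: "derives G (Inl B # \<gamma>) (map Inr z1 @ \<gamma>)"
    using derives_in_context[of G _ "[]", OF _ yields_derives[OF yields_Inl.hyps(3)], of _ \<gamma>] B
    by simp
  have B2: "derives G (Inl B # \<gamma>) ([Inl B] @ map Inr z2)"
    using derives_context[OF yields_derives[OF yields_Inl.hyps(4)], of "[Inl B]" "[]"] by simp
  have B3: "derives G (Inl B # \<gamma>) (\<beta> @ map Inr z2)"
    using derives_in_context[of G _ \<beta> \<gamma> "[]"] B yields_derives[OF yields_Inl.hyps(4)] by simp
  \<comment> \<open>A cut inside a subtree is preferred; only if both subtrees avoid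
    \<open>A\<close> is the node \<open>B\<close> compared with \<open>A\<close>. So nothing below
    the chosen \<open>A\<close> expands \<open>A\<close> again.\<close>
  consider "?cut \<gamma> z2" | "?cut \<beta> z1" | "yields G (insert A M) \<beta> z1" "yields G (insert A M) \<gamma> z2"
    using yields_Inl.IH by blast
  then show ?case
  proof cases
    case 1
    then obtain x y z' \<alpha> where *: "derives G \<gamma> (map Inr x @ [Inl A] @ map Inr y)"
      "(A, \<alpha>) \<in> productions G" "yields G (insert A M) \<alpha> z'" "z2 = x @ z' @ y" by blast
    have "derives G (Inl B # \<gamma>) (map Inr (z1 @ x) @ [Inl A] @ map Inr y)"
      using derives_in_context[of G _ "map Inr z1" \<gamma> "[]"] B1 *(1) by simp
    moreover have "z1 @ z2 = (z1 @ x) @ z' @ y"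
      using * by simp
    ultimately show ?thesis
      using *(2,3) by blast
  next
    case 2
    then obtain x y z' \<alpha> where *: "derives G \<beta> (map Inr x @ [Inl A] @ map Inr y)"
      "(A, \<alpha>) \<in> productions G" "yields G (insert A M) \<alpha> z'" "z1 = x @ z' @ y" by blast
    have "derives G (Inl B # \<gamma>) (map Inr x @ [Inl A] @ map Inr (y @ z2))"
      using derives_in_context[OF _ *(1), of "Inl B # \<gamma>" "[]" "map Inr z2"] B3 by simp
    moreover have "z1 @ z2 = x @ z' @ y @ z2"
      using * by simp
    ultimately show ?thesis
      using *(2,3) by blast
  next
    case 3
    show ?thesis
    proof (cases "B = A")
      case True
      have "derives G (Inl B # \<gamma>) (map Inr [] @ [Inl A] @ map Inr z2)"
        using B2 True by simp
      moreover have "z1 @ z2 = [] @ z1 @ z2"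
        by simp
      ultimately show ?thesis
        using 3(1) yields_Inl.hyps(2) True by blast
    next
      case False
      then show ?thesis
        using 3 yields_Inl.hyps by (auto intro: yields.intros)
    qed
  qed
qed

section \<open>Soundness of grammars by interpreting nonterminals as languages\<close>

fun subst :: "('n \<Rightarrow> 't list set) \<Rightarrow> ('n + 't) list \<Rightarrow> 't list set" where
  "subst I [] = {[]}"
| "subst I (Inr a # \<gamma>) = (#) a ` subst I \<gamma>"
| "subst I (Inl A # \<gamma>) = {x @ y | x y. x \<in> I A \<and> y \<in> subst I \<gamma>}"

lemma subst_map_Inr_append [simp]: "subst I (map Inr x @ \<gamma>) = (@) x ` subst I \<gamma>"
  by (induction x) (auto simp: image_image)

lemma subst_map_Inr [simp]: "subst I (map Inr x) = {x}"
  using subst_map_Inr_append[of I x "[]"] by simp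

text \<open>Languages closed under all productions contain every derivable word, by induction on the
  derivation tree. This shows that the grammar built below generates nothing unwanted.\<close>

lemma derives_imp_subst:
  assumes "\<And>A \<alpha>. (A, \<alpha>) \<in> productions G \<Longrightarrow> subst I \<alpha> \<subseteq> I A"
    and "derives G \<gamma> (map Inr z)"
  shows "z \<in> subst I \<gamma>"
proof -
  have "yields G {} \<gamma> z" using assms(2) by (rule derives_yields)
  then show ?thesis
    by (induction rule: yields.induct) (use assms(1) in \<open>auto, blast\<close>)
qed

section \<open>The upper bound\<close>

text \<open>\<open>P\<close> is the root of \<open>x0\<close> raised to the product \<open>D\<close>
  of all lengths. The exponent of \<open>x\<close> over its root divides \<open>length x\<close>,
  hence \<open>D\<close>, so some power of \<open>x\<close> is its own root to the power
  \<open>D\<close>, a rotation of \<open>P\<close>.\<close>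

lemma class_core:
  assumes "finite X" "x0 \<in> X" "\<And>x. x \<in> X \<Longrightarrow> (x0, x) \<in> conj_rel"
  shows "\<exists>P. P \<in> lists (set x0) \<and> (\<forall>x\<in>X. \<exists>K v z. K \<ge> 1 \<and> wpow x K = v @ z \<and> P = z @ v)"
proof -
  define D where "D = (\<Prod>x\<in>X. length x)"
  have ne: "x \<noteq> []" if "x \<in> X" for x
    using assms(3)[OF that] by (simp add: conj_rel_iff_rotate)
  have D: "D \<ge> 1"
    using ne by (auto simp: D_def Suc_le_eq intro!: prod_pos)
  define P where "P = wpow (root x0) D"
  \<comment> \<open>This representation shows that \<open>P\<close> uses only letters of
    \<open>x0\<close>, so that it fits the terminal alphabet.\<close>
  obtain e0 where "x0 = wpow (root x0) e0" "e0 \<ge> 1"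
    using ex_wpow_root ne assms(2) by blast
  then have "set (root x0) \<subseteq> set x0"
    by (cases e0) (metis not_one_le_zero, metis wpow_Suc set_append sup_ge1)
  then have "P \<in> lists (set x0)"
    by (auto simp: P_def wpow_def)
  moreover have "\<exists>K v z. K \<ge> 1 \<and> wpow x K = v @ z \<and> P = z @ v" if x: "x \<in> X" for x
  proof -
    obtain e where e: "x = wpow (root x) e" "e \<ge> 1"
      using ex_wpow_root ne x by blast
    have "e dvd length x"
      using e by (metis length_wpow dvd_triv_left)
    also have "length x dvd D"
      unfolding D_def using assms(1) x by (rule dvd_prodI)
    finally obtain K where K: "D = e * K" ..
    have "(x, x0) \<in> conj_rel"
      using assms(3)[OF x] by (rule conj_rel_sym)
    then obtain n where n: "root x0 = rotate n (root x)"
      by (auto simp: conj_rel_iff_rotate)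
    have xK: "wpow x K = wpow (root x) D"
      using e K by (metis wpow_mult)
    then have "P = rotate n (wpow x K)"
      by (simp add: P_def n rotate_wpow)
    then have "\<exists>v z. wpow x K = v @ z \<and> P = z @ v"
      by (metis append_take_drop_id rotate_drop_take)
    moreover have "K \<ge> 1"
      using D K by (cases K) auto
    ultimately show ?thesis by blast
  qed
  ultimately show ?thesis by blast
qed

lemma wpow_decomp:
  assumes "wpow x K = v @ z"
  shows "wpow x (K * j + r) = wpow x r @ wpow (v @ z) j"
  using assms by (metis add.commute wpow_add wpow_mult)

text \<open>Nonterminal 0 is the start; each \<open>i\<close> in \<open>{1..N}\<close> generates the
  powers of \<open>P i\<close>. Exponents are divided by \<open>K x\<close>: \<open>short\<close>
  supplies a remainder alone, \<open>long\<close> a remainder followed by at least one full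
  block.\<close>

lemma ex_cfg_union_wstar:
  assumes fin: "finite W" and c: "\<And>x. x \<in> W \<Longrightarrow> c x \<in> {1..N::nat}"
    and core: "\<And>x. x \<in> W \<Longrightarrow> K x \<ge> 1 \<and> wpow x (K x) = v x @ z x \<and> P (c x) = z x @ v x"
    and lists: "\<And>i. i \<in> {1..N} \<Longrightarrow> P i \<in> lists (\<Union> (set ` W))"
  shows "\<exists>G :: (nat, 'a) cfg. is_cfg G \<and> language G = (\<Union>x\<in>W. wstar (x :: 'a list)) \<and>
    card (nonterminals G) = Suc N"
proof -
  define short where "short = (\<lambda>(x, r). (0 :: nat, map Inr (wpow x r) :: (nat + 'a) list))"
  define long where "long = (\<lambda>(x, r). (0 :: nat,
    map Inr (wpow x r @ v x) @ [Inl (c x)] @ map Inr (z x) :: (nat + 'a) list))"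
  define I where "I = (SIGMA x:W. {..<K x})"
  define step where "step = (\<lambda>i. (i :: nat, map Inr (P i) @ [Inl i] :: (nat + 'a) list))"
  define stop where "stop = (\<lambda>i. (i :: nat, [] :: (nat + 'a) list))"
  define G :: "(nat, 'a) cfg" where "G = \<lparr>nonterminals = {0..N}, terminals = \<Union> (set ` W),
    productions = short ` I \<union> long ` I \<union> step ` {1..N} \<union> stop ` {1..N}, start = 0\<rparr>"
  have sel: "nonterminals G = {0..N}" "terminals G = \<Union> (set ` W)" "start G = 0"
    "productions G = short ` I \<union> long ` I \<union> step ` {1..N} \<union> stop ` {1..N}"
    by (simp_all add: G_def)
  let ?L = "\<Union>x\<in>W. wstar x"
  have x_lists: "set (wpow x r) \<subseteq> \<Union> (set ` W)" if "x \<in> W" for x r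
    using that by (auto simp: wpow_def)
  have vz_lists: "set (v x) \<subseteq> \<Union> (set ` W)" "set (z x) \<subseteq> \<Union> (set ` W)" if "x \<in> W" for x
    using x_lists[OF that, of "K x"] core[OF that] by auto
  have sub: "\<gamma> \<in> lists (nonterminals G <+> terminals G) \<longleftrightarrow>
      (\<forall>A. Inl A \<in> set \<gamma> \<longrightarrow> A \<le> N) \<and> (\<forall>a. Inr a \<in> set \<gamma> \<longrightarrow> a \<in> \<Union> (set ` W))" for \<gamma>
  proof -
    have "X \<in> nonterminals G <+> terminals G \<longleftrightarrow>
        (\<forall>A. X = Inl A \<longrightarrow> A \<le> N) \<and> (\<forall>a. X = Inr a \<longrightarrow> a \<in> \<Union> (set ` W))" for X
      by (cases X) (auto simp: G_def)
    then show ?thesis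
      unfolding in_lists_conv_set by blast
  qed
  have "is_cfg G"
  proof -
    have "finite I"
      using fin by (auto simp: I_def)
    have "short p \<in> {0..N} \<times> lists (nonterminals G <+> terminals G)"
      "long p \<in> {0..N} \<times> lists (nonterminals G <+> terminals G)" if p: "p \<in> I" for p
    proof -
      obtain x r where "p = (x, r)" "x \<in> W"
        using p by (auto simp: I_def)
      then show "short p \<in> {0..N} \<times> lists (nonterminals G <+> terminals G)"
        "long p \<in> {0..N} \<times> lists (nonterminals G <+> terminals G)"
        using x_lists[of x r] vz_lists[of x] c[of x]
        by (auto simp: short_def long_def sub simp del: in_lists_conv_set)
    qed
    moreover have "step i \<in> {0..N} \<times> lists (nonterminals G <+> terminals G)"
      "stop i \<in> {0..N} \<times> lists (nonterminals G <+> terminals G)" if "i \<in> {1..N}" for i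
      using lists[OF that] that by (auto simp: step_def stop_def G_def)
    ultimately have "productions G \<subseteq> nonterminals G \<times> lists (nonterminals G <+> terminals G)"
      unfolding sel by blast
    moreover have "finite (productions G)"
      using \<open>finite I\<close> by (simp add: sel)
    ultimately show ?thesis
      using fin by (simp add: is_cfg_def sel)
  qed
  moreover have "language G = ?L"
  proof (intro equalityI subsetI)
    fix y assume "y \<in> language G"
    then have y: "derives G [Inl 0] (map Inr y)"
      by (simp add: language_def G_def)
    \<comment> \<open>The start symbol is interpreted by the target language and \<open>i\<close> by
      the powers of \<open>P i\<close>; closure is then checked for each kind of production.\<close>
    define J where "J i = (if i = 0 then ?L else range (wpow (P i)))" for i
    have "subst J \<alpha> \<subseteq> J A" if "(A, \<alpha>) \<in> productions G" for A \<alpha>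
    proof -
      consider x r where "x \<in> W" "(A, \<alpha>) = short (x, r)" | x r where "x \<in> W" "(A, \<alpha>) = long (x, r)"
        | i where "i \<in> {1..N}" "(A, \<alpha>) = step i" | i where "i \<in> {1..N}" "(A, \<alpha>) = stop i"
        using \<open>(A, \<alpha>) \<in> productions G\<close> by (auto simp: G_def I_def)
      then show ?thesis
      proof cases
        case 1
        then show ?thesis by (auto simp: short_def J_def wstar_def)
      next
        case 2
        have "wpow x r @ v x @ wpow (P (c x)) j @ z x \<in> wstar x" for j
        proof -
          have "v x @ wpow (P (c x)) j @ z x = wpow (v x @ z x) (Suc j)"
            using core[OF 2(1)] wpow_slide[of "z x" "v x" j] by (simp add: wpow_Suc)
          then have "wpow x r @ v x @ wpow (P (c x)) j @ z x = wpow x (K x * Suc j + r)"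
            using core[OF 2(1)] wpow_decomp[of x "K x" "v x" "z x" "Suc j" r]
            by (simp del: mult_Suc_right)
          then show ?thesis by (simp add: wstar_def)
        qed
        then have "wpow x r @ v x @ wpow (P (c x)) j @ z x \<in> ?L" for j
          using 2(1) by blast
        then show ?thesis
          using 2 c[OF 2(1)] subst_map_Inr_append[of J "z x" "[]"]
          by (auto simp: long_def J_def simp del: map_append)
      next
        case 3
        have "P i @ wpow (P i) j \<in> range (wpow (P i))" for j
          by (metis rangeI wpow_Suc)
        then show ?thesis
          using 3 by (auto simp: step_def J_def)
      next
        case 4
        have "[] \<in> range (wpow (P i))"
          by (metis rangeI wpow_0)
        then show ?thesis
          using 4 by (auto simp: stop_def J_def)
      qed
    qed
    from derives_imp_subst[OF this y] show "y \<in> ?L"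
      by (auto simp: J_def)
  next
    fix y assume "y \<in> ?L"
    then obtain x m where x: "x \<in> W" and y: "y = wpow x m"
      by (auto simp: wstar_def)
    define r j where "r = m mod K x" and "j = m div K x"
    have rI: "(x, r) \<in> I"
      using core[OF x] x by (auto simp: I_def r_def)
    have m: "m = K x * j + r"
      by (simp add: r_def j_def)
    have "derives G [Inl 0] (map Inr y)"
    proof (cases j)
      case 0
      have "(0, map Inr (wpow x r)) \<in> productions G"
        using rI by (force simp: G_def short_def)
      then show ?thesis
        using derives_production y m 0 by fastforce
    next
      \<comment> \<open>The frame \<open>v x\<close>, \<open>z x\<close> of the \<open>long\<close>
        production already makes one block, so the class nonterminal supplies the remaining
        \<open>l\<close>.\<close>
      case (Suc l)
      have ci: "c x \<in> {1..N}" using c[OF x] .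
      have A: "derives G [Inl (c x)] (map Inr (wpow (P (c x)) l))"
      proof -
        have "(c x, []) \<in> productions G"
          using ci by (force simp: G_def stop_def)
        then have "derives G [Inl (c x)] (map Inr [])"
          using derives_production by fastforce
        moreover have "(c x, map Inr (P (c x)) @ [Inl (c x)]) \<in> productions G"
          using ci by (force simp: G_def step_def)
        then have "reaches G (c x) (P (c x)) (c x) []"
          using derives_production by fastforce
        then have "reaches G (c x) (wpow (P (c x)) l) (c x) (wpow [] l)"
          by (rule reaches_wpow)
        ultimately show ?thesis
          using reaches_derives by (fastforce simp: wpow_def)
      qed
      have "(0, map Inr (wpow x r @ v x) @ [Inl (c x)] @ map Inr (z x)) \<in> productions G"
        using rI by (force simp: G_def long_def)
      then have "derives G [Inl 0] (map Inr ((wpow x r @ v x) @ wpow (P (c x)) l @ z x))"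
        using reaches_derives[OF derives_production A] by blast
      moreover have "v x @ wpow (P (c x)) l @ z x = wpow (v x @ z x) (Suc l)"
        using core[OF x] wpow_slide[of "z x" "v x" l] by (simp add: wpow_Suc)
      then have "(wpow x r @ v x) @ wpow (P (c x)) l @ z x = y"
        using core[OF x] wpow_decomp[of x "K x" "v x" "z x" "Suc l" r] y m Suc
        by (simp del: mult_Suc_right)
      ultimately show ?thesis by (simp only:)
    qed
    then show "y \<in> language G"
      by (simp add: language_def G_def)
  qed
  moreover have "card (nonterminals G) = Suc N"
    by (simp add: G_def)
  ultimately show ?thesis by blast
qed

lemma equiv_Restr_conj_rel:
  assumes "[] \<notin> W"
  shows "equiv W (Restr conj_rel W)"
proof (rule equivI)
  have "(x, x) \<in> conj_rel" if "x \<in> W" for x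
    using equiv_class_self[OF equiv_conj_rel, of x] that assms by auto
  then show "refl_on W (Restr conj_rel W)"
    by (auto simp: refl_on_def)
  show "sym (Restr conj_rel W)"
    by (auto intro: symI conj_rel_sym)
  show "trans (Restr conj_rel W)"
    by (auto intro: transI conj_rel_trans)
qed auto

lemma ex_cfg_conj_classes:
  assumes fin: "finite W" and ne: "[] \<notin> W"
  shows "\<exists>G :: (nat, 'a) cfg. is_cfg G \<and> language G = (\<Union>x\<in>W. wstar (x :: 'a list)) \<and>
    card (nonterminals G) = Suc (card (W // Restr conj_rel W))"
proof -
  let ?R = "Restr conj_rel W"
  have eq: "equiv W ?R" using ne by (rule equiv_Restr_conj_rel)
  have "finite (W // ?R)"
    using fin by (simp add: quotient_def)
  \<comment> \<open>Classes are numbered from 1 because 0 is reserved for the start symbol.\<close>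
  then obtain h where h: "bij_betw h (W // ?R) {1..card (W // ?R)}"
    using finite_same_card_bij[of "W // ?R" "{1..card (W // ?R)}"] by auto
  define c where "c x = h (?R `` {x})" for x
  have c: "c x \<in> {1..card (W // ?R)}" if "x \<in> W" for x
    using h that quotientI[OF that] unfolding c_def by (meson bij_betwE)
  have cls: "\<exists>P. P \<in> lists (\<Union> (set ` W)) \<and>
      (\<forall>x\<in>W. c x = i \<longrightarrow> (\<exists>K v z. K \<ge> 1 \<and> wpow x K = v @ z \<and> P = z @ v))"
    if i: "i \<in> {1..card (W // ?R)}" for i
  proof -
    obtain X where X: "X \<in> W // ?R" "h X = i"
      using h i by (metis bij_betw_imp_surj_on imageE)
    then obtain x0 where x0: "x0 \<in> W" "X = ?R `` {x0}"
      by (auto elim: quotientE)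
    have "x0 \<in> X"
      using equiv_class_self[OF eq x0(1)] x0(2) by simp
    then obtain P where P: "P \<in> lists (set x0)"
      "\<forall>x\<in>X. \<exists>K v z. K \<ge> 1 \<and> wpow x K = v @ z \<and> P = z @ v"
      using class_core[of X x0] fin x0 by (auto simp: finite_subset[of X W])
    have "x \<in> X" if "x \<in> W" "c x = i" for x
    proof -
      have "?R `` {x} = X"
        using h X that quotientI[of x W ?R] unfolding c_def by (metis bij_betw_def inj_onD)
      then show ?thesis
        using that eq by (metis equiv_class_self)
    qed
    then show ?thesis
      using P x0 by (intro exI[of _ P]) auto
  qed
  then obtain P where P: "\<And>i. i \<in> {1..card (W // ?R)} \<Longrightarrow> P i \<in> lists (\<Union> (set ` W)) \<and>
      (\<forall>x\<in>W. c x = i \<longrightarrow> (\<exists>K v z. K \<ge> 1 \<and> wpow x K = v @ z \<and> P i = z @ v))"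
    by metis
  have "\<exists>K v z. K \<ge> 1 \<and> wpow x K = v @ z \<and> P (c x) = z @ v" if "x \<in> W" for x
    using P[OF c[OF that]] that by blast
  then obtain K v z where core:
    "\<And>x. x \<in> W \<Longrightarrow> K x \<ge> 1 \<and> wpow x (K x) = v x @ z x \<and> P (c x) = z x @ v x"
    by metis
  show ?thesis
  proof (rule ex_cfg_union_wstar)
    show "P i \<in> lists (\<Union> (set ` W))" if "i \<in> {1..card (W // ?R)}" for i
      using P[OF that] by (rule conjunct1)
  qed (fact fin c core)+
qed

section \<open>The lower bound\<close>

locale union_wstar_cfg =
  fixes G :: "('n, 't) cfg" and W :: "'t list set"
  assumes cfg: "is_cfg G" and lang: "language G = (\<Union>w\<in>W. wstar w)"
    and fin: "finite W" and Nil_notin: "[] \<notin> W"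
begin

text \<open>One bound for all words of \<open>W\<close>: it serves as exponent in
  \<open>conj_rel_if_sublist_wpow\<close>, and its square bounds the product of any two
  lengths.\<close>

definition len where "len = (\<Sum>w\<in>W. length w)"

lemma length_le_len: "w \<in> W \<Longrightarrow> length w \<le> len"
  unfolding len_def using fin by (rule member_le_sum[rotated 2]) auto

text \<open>Reachability and productivity put every iteration of the loop into a word of the
  language. Since \<open>conj_rel\<close> compares roots, \<open>p\<close> may be conjugate to any
  power of the root of \<open>w\<close>.\<close>

definition pumps :: "'n \<Rightarrow> 't list \<Rightarrow> bool" where
  "pumps A w \<longleftrightarrow> (\<exists>x y. reaches G (start G) x A y) \<and> (\<exists>z. derives G [Inl A] (map Inr z)) \<and>
    (\<exists>u v p. reaches G A u A v \<and> p \<in> {u, v} \<and> (p, w) \<in> conj_rel)"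

lemma pump_word:
  assumes "reaches G (start G) x A y" "reaches G A u A v" "derives G [Inl A] (map Inr z)"
  obtains w t where "w \<in> W" "x @ wpow u a @ z @ wpow v a @ y = wpow w t"
proof -
  have "derives G [Inl (start G)] (map Inr (x @ (wpow u a @ z @ wpow v a) @ y))"
    by (rule reaches_derives[OF assms(1) reaches_derives[OF reaches_wpow[OF assms(2)] assms(3)]])
  then have "x @ wpow u a @ z @ wpow v a @ y \<in> language G"
    by (simp add: language_def)
  then show ?thesis
    using that lang by (auto simp: wstar_def)
qed

lemma sublist_pump:
  assumes "p \<in> {u, v}"
  shows "sublist (wpow p a) (x @ wpow u a @ z @ wpow v a @ y)"
  using assms sublist_appendI[of "wpow u a" x "z @ wpow v a @ y"]
    sublist_appendI[of "wpow v a" "x @ wpow u a @ z" y] by auto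

text \<open>The second loop is iterated inside the first, so a single power of some \<open>w\<close>
  in \<open>W\<close> contains the \<open>len\<close>-th power of a side of each. Both sides are
  then related to \<open>w\<close>.\<close>

lemma pumps_conj_rel:
  assumes "pumps A w1" "pumps A w2"
  shows "(w1, w2) \<in> conj_rel"
proof -
  obtain x y z u v p u' v' p' where *: "reaches G (start G) x A y" "derives G [Inl A] (map Inr z)"
    "reaches G A u A v" "p \<in> {u, v}" "(p, w1) \<in> conj_rel"
    "reaches G A u' A v'" "p' \<in> {u', v'}" "(p', w2) \<in> conj_rel"
    using assms unfolding pumps_def by metis
  have "derives G [Inl A] (map Inr (wpow u' len @ z @ wpow v' len))"
    by (rule reaches_derives[OF reaches_wpow[OF *(6)] *(2)])
  from pump_word[OF *(1,3) this, of len] obtain w t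
    where w: "w \<in> W" "x @ wpow u len @ (wpow u' len @ z @ wpow v' len) @ wpow v len @ y = wpow w t"
    by blast
  have "sublist (wpow p len) (wpow w t)"
    using sublist_pump[OF *(4)] w(2) by metis
  moreover have "sublist (wpow p' len) (wpow w t)"
    using sublist_pump[OF *(7), of len "x @ wpow u len" z "wpow v len @ y"] w(2)
    by (metis append.assoc)
  moreover have "w \<noteq> []" "p \<noteq> []" "p' \<noteq> []" "length w \<le> len"
    using Nil_notin w * length_le_len by (auto simp: conj_rel_iff_rotate)
  ultimately have "(p, w) \<in> conj_rel" "(p', w) \<in> conj_rel"
    using conj_rel_if_sublist_wpow by blast+
  then show ?thesis
    using * conj_rel_sym conj_rel_trans by meson
qed

text \<open>Pumping puts a high power of \<open>p\<close> into a power of some \<open>w'\<close>,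
  which relates \<open>p\<close> to \<open>w'\<close>. As \<open>p\<close> is also a long factor of
  a power of \<open>w\<close>, the words \<open>w\<close> and \<open>w'\<close> are related, and
  transitivity finishes.\<close>

lemma pumps_if_long:
  assumes w: "w \<in> W" and A: "reaches G (start G) x A y" "derives G [Inl A] (map Inr z)"
    and uv: "reaches G A u A v" "p \<in> {u, v}"
    and p: "sublist p (wpow w m)" "len * len < length p"
  shows "pumps A w"
proof -
  have "p \<noteq> []" using p by auto
  \<comment> \<open>The exponent is at least \<open>len\<close>, as the factor criterion demands,
    and a successor, so that one copy of \<open>p\<close> splits off.\<close>
  obtain w' t where w': "w' \<in> W" "x @ wpow u (Suc len) @ z @ wpow v (Suc len) @ y = wpow w' t"
    using pump_word[OF A(1) uv(1) A(2)] by metis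
  have ne: "w \<noteq> []" "w' \<noteq> []" using w w' Nil_notin by auto
  have s: "sublist (wpow p (Suc len)) (wpow w' t)"
    using sublist_pump[OF uv(2)] w'(2) by metis
  have "(p, w') \<in> conj_rel"
    using conj_rel_if_sublist_wpow[OF s] \<open>p \<noteq> []\<close> ne length_le_len[OF w'(1)] by simp
  moreover have "sublist p (wpow w' t)"
    using sublist_order.order_trans[OF _ s] sublist_appendI[of p "[]" "wpow p len"]
    by (simp add: wpow_Suc)
  moreover have "length w * length w' \<le> length p"
    using mult_le_mono[OF length_le_len[OF w] length_le_len[OF w'(1)]] p(2) by linarith
  ultimately have "(p, w) \<in> conj_rel"
    using conj_rel_if_common_sublist[OF p(1) _ ne] conj_rel_sym conj_rel_trans by meson
  then show ?thesis
    using A uv unfolding pumps_def by blast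
qed

text \<open>A terminal contributes one letter and a nonterminal at most \<open>B\<close>, so
  \<open>Suc B\<close> per symbol suffices. The derivation from the start symbol is carried along
  because \<open>B\<close> applies only to nonterminals reached in a terminal context.\<close>

lemma length_le_if_yields:
  assumes "yields G M \<gamma> z" "derives G [Inl (start G)] (map Inr x @ \<gamma> @ map Inr y)"
    and "sublist z (wpow w m)"
    and "\<And>A x y z. reaches G (start G) x A y \<Longrightarrow> yields G M [Inl A] z \<Longrightarrow>
      sublist z (wpow w m) \<Longrightarrow> length z \<le> B"
  shows "length z \<le> length \<gamma> * Suc B"
  using assms(1-3)
proof (induction arbitrary: x y rule: yields.induct)
  case (yields_Inr \<gamma> z a)
  have "derives G [Inl (start G)] (map Inr (x @ [a]) @ \<gamma> @ map Inr y)"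
    using yields_Inr.prems(1) by simp
  moreover have "sublist z (wpow w m)"
    using sublist_order.order_trans[OF _ yields_Inr.prems(2)] sublist_appendI[of z "[a]" "[]"]
    by simp
  ultimately show ?case
    using yields_Inr.IH by fastforce
next
  case (yields_Inl A \<alpha> z1 \<gamma> z2)
  have sub: "sublist z1 (wpow w m)" "sublist z2 (wpow w m)"
    using sublist_order.order_trans[OF _ yields_Inl.prems(2)]
      sublist_appendI[of z1 "[]" z2] sublist_appendI[of z2 z1 "[]"] by simp_all
  have z1: "yields G M [Inl A] z1"
    using yields.yields_Inl[OF yields_Inl.hyps(1-3) yields_Nil] by simp
  \<comment> \<open>The symbols to the right are expanded first to give \<open>A\<close> a terminal
    context; for the bound on those symbols it is \<open>A\<close> that is expanded first.\<close>
  have "reaches G (start G) x A (z2 @ y)"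
    using derives_in_context[OF _ yields_derives[OF yields_Inl.hyps(4)],
        of "[Inl (start G)]" "map Inr x @ [Inl A]" "map Inr y"] yields_Inl.prems(1) by simp
  then have "length z1 \<le> B"
    using assms(4) z1 sub by blast
  moreover have "derives G [Inl (start G)] (map Inr (x @ z1) @ \<gamma> @ map Inr y)"
    using derives_in_context[OF _ yields_derives[OF z1],
        of "[Inl (start G)]" "map Inr x" "\<gamma> @ map Inr y"] yields_Inl.prems(1) by simp
  then have "length z2 \<le> length \<gamma> * Suc B"
    using yields_Inl.IH(2) sub by blast
  ultimately show ?case by simp
qed simp

text \<open>Induction on the nonterminals that may still be expanded: cutting at the last occurrence of
  \<open>A\<close> gives a loop at \<open>A\<close>, whose two sides are short because otherwise \<open>A\<close> would pump, and below
  the cut \<open>A\<close> is no longer available.\<close>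

lemma bounded_if_not_pumps:
  assumes w: "w \<in> W" and no: "\<And>A. A \<in> nonterminals G \<Longrightarrow> \<not> pumps A w"
  shows "\<exists>B. \<forall>A x y z m. reaches G (start G) x A y \<longrightarrow> yields G M [Inl A] z \<longrightarrow>
    sublist z (wpow w m) \<longrightarrow> length z \<le> B"
proof (induction "card (nonterminals G - M)" arbitrary: M rule: less_induct)
  case less
  have finN: "finite (nonterminals G)" and finP: "finite (productions G)"
    and PN: "\<And>A \<alpha>. (A, \<alpha>) \<in> productions G \<Longrightarrow> A \<in> nonterminals G"
    using cfg by (auto simp: is_cfg_def)
  have "\<exists>B. \<forall>A' x y z m. reaches G (start G) x A' y \<longrightarrow> yields G (insert A M) [Inl A'] z \<longrightarrow>
    sublist z (wpow w m) \<longrightarrow> length z \<le> B" if "A \<in> nonterminals G - M" for A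
  proof (rule less.hyps)
    have "nonterminals G - insert A M \<subset> nonterminals G - M"
      using that by blast
    then show "card (nonterminals G - insert A M) < card (nonterminals G - M)"
      using finN by (simp only: psubset_card_mono finite_Diff)
  qed
  then obtain B where B: "\<And>A A' x y z m. A \<in> nonterminals G - M \<Longrightarrow> reaches G (start G) x A' y \<Longrightarrow>
    yields G (insert A M) [Inl A'] z \<Longrightarrow> sublist z (wpow w m) \<Longrightarrow> length z \<le> B A"
    by metis
  \<comment> \<open>Each side of the loop has at most \<open>len * len\<close> letters; the sum over
    all productions replaces a maximum for the part below the cut.\<close>
  define C where "C = 2 * len * len + (\<Sum>(A, \<alpha>)\<in>productions G. length \<alpha> * Suc (B A))"
  have "length z \<le> C" if S: "reaches G (start G) x A y" and z: "yields G M [Inl A] z"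
    and sub: "sublist z (wpow w m)" for A x y z m
  proof -
    \<comment> \<open>A tree rooted at \<open>A\<close> expands \<open>A\<close>, so
      \<open>yields_last_occurrence\<close> must provide a cut.\<close>
    have notin: "\<not> yields G (insert A M) [Inl A] z"
      by (auto elim: yields_InlE)
    have A: "A \<in> nonterminals G - M"
      using z PN by (auto elim: yields_InlE)
    obtain u v z' \<alpha> where *: "reaches G A u A v" "(A, \<alpha>) \<in> productions G"
      "yields G (insert A M) \<alpha> z'" "z = u @ z' @ v"
      using yields_last_occurrence[OF z, of A] notin by blast
    have z': "derives G [Inl A] (map Inr z')"
      using derives_production[OF *(2)] yields_derives[OF *(3)] by (rule rtranclp_trans)
    have subs: "sublist u (wpow w m)" "sublist z' (wpow w m)" "sublist v (wpow w m)"
      using sublist_order.order_trans[OF _ sub[unfolded *(4)]] sublist_appendI[of u "[]" "z' @ v"]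
        sublist_appendI[of z' u v] sublist_appendI[of v "u @ z'" "[]"] by simp_all
    have "length u \<le> len * len" "length v \<le> len * len"
      using pumps_if_long[OF w S z' *(1)] no A subs by (meson DiffD1 insertCI not_le)+
    moreover have "length z' \<le> length \<alpha> * Suc (B A)"
    proof (rule length_le_if_yields[OF *(3) _ subs(2)])
      have "reaches G (start G) (x @ u) A (v @ y)"
        using reaches_trans[OF S *(1)] .
      from derives_in_context[OF this derives_production[OF *(2)]]
      show "derives G [Inl (start G)] (map Inr (x @ u) @ \<alpha> @ map Inr (v @ y))" .
    qed (use B[OF A] in blast)
    moreover have "length \<alpha> * Suc (B A) \<le> (\<Sum>(A, \<alpha>)\<in>productions G. length \<alpha> * Suc (B A))"
      using member_le_sum[OF *(2), of "\<lambda>(A, \<alpha>). length \<alpha> * Suc (B A)"] finP by auto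
    ultimately show ?thesis
      using *(4) by (simp add: C_def)
  qed
  then show ?case by blast
qed

text \<open>Otherwise \<open>bounded_if_not_pumps\<close>, applied to the start symbol with nothing
  forbidden, would bound the lengths of all powers of \<open>w\<close>.\<close>

lemma ex_pumps:
  assumes "w \<in> W"
  shows "\<exists>A\<in>nonterminals G. pumps A w"
proof (rule ccontr)
  assume "\<not> ?thesis"
  then obtain B where B: "\<And>A x y z m. reaches G (start G) x A y \<Longrightarrow> yields G {} [Inl A] z \<Longrightarrow>
    sublist z (wpow w m) \<Longrightarrow> length z \<le> B"
    using bounded_if_not_pumps[OF assms, of "{}"] by blast
  have "wpow w (Suc B) \<in> language G"
    using assms lang by (auto simp: wstar_def)
  then have "yields G {} [Inl (start G)] (wpow w (Suc B))"
    by (auto simp: language_def intro: derives_yields)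
  moreover have "reaches G (start G) [] (start G) []" by simp
  ultimately have "length (wpow w (Suc B)) \<le> B"
    using B by blast
  moreover have "1 \<le> length w"
    using assms Nil_notin by (cases w) auto
  then have "Suc B \<le> length (wpow w (Suc B))"
    using mult_le_mono2[of 1 "length w" "Suc B"] by (simp only: length_wpow mult_1_right)
  ultimately show False
    by simp
qed

text \<open>A loop at the start symbol wraps any word of the language. Around
  \<open>wpow w' len\<close> it gives a power of some \<open>x\<close> in \<open>W\<close> with the
  pumped side flush at one end, so every \<open>w'\<close> in \<open>W\<close> has the root of that
  side.\<close>

lemma commute_if_pumps_start:
  assumes "pumps (start G) w" "w1 \<in> W" "w2 \<in> W"
  shows "w1 @ w2 = w2 @ w1"
proof -
  obtain u v p where uv: "reaches G (start G) u (start G) v" and p: "p \<in> {u, v}" "p \<noteq> []"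
    using assms(1) unfolding pumps_def by (auto simp: conj_rel_iff_rotate)
  have "root w' = root p" if w': "w' \<in> W" for w'
  proof -
    have "wpow w' len \<in> language G"
      using w' lang by (auto simp: wstar_def)
    then have "derives G [Inl (start G)] (map Inr (wpow w' len))"
      by (simp add: language_def)
    with uv obtain x t where x: "x \<in> W" "wpow u len @ wpow w' len @ wpow v len = wpow x t"
      using pump_word[of "[]" "start G" "[]" u v "wpow w' len" len] by auto
    have ne: "w' \<noteq> []" "x \<noteq> []" using w' x Nil_notin by auto
    show ?thesis
    proof (cases "p = u")
      case True
      then show ?thesis
        using root_eq_if_pumped_left[OF x(2)] p ne length_le_len[OF x(1)] by blast
    next
      case False
      then show ?thesis
        using root_eq_if_pumped_right[OF x(2)] p ne length_le_len[OF x(1)] by blast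
    qed
  qed
  then show ?thesis
    using assms Nil_notin commute_iff_root_eq by metis
qed

text \<open>Sending a class to a nonterminal that pumps one of its members is injective by
  \<open>pumps_conj_rel\<close>, and it misses the start symbol because \<open>w1\<close> and
  \<open>w2\<close> do not commute; this gives the extra one.\<close>

lemma Suc_card_classes_le:
  assumes "w1 \<in> W" "w2 \<in> W" "w1 @ w2 \<noteq> w2 @ w1"
  shows "Suc (card (W // Restr conj_rel W)) \<le> card (nonterminals G)"
proof -
  let ?R = "Restr conj_rel W"
  have "\<exists>A. A \<in> nonterminals G - {start G} \<and> (\<exists>w\<in>W. X = ?R `` {w} \<and> pumps A w)"
    if X: "X \<in> W // ?R" for X
  proof -
    obtain w where "w \<in> W" "X = ?R `` {w}"
      using X by (auto elim: quotientE)
    then show ?thesis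
      using ex_pumps commute_if_pumps_start assms by blast
  qed
  then obtain f where f: "\<And>X. X \<in> W // ?R \<Longrightarrow>
      f X \<in> nonterminals G - {start G} \<and> (\<exists>w\<in>W. X = ?R `` {w} \<and> pumps (f X) w)"
    by metis
  have "inj_on f (W // ?R)"
  proof (rule inj_onI)
    fix X Y assume XY: "X \<in> W // ?R" "Y \<in> W // ?R" "f X = f Y"
    obtain a b where "a \<in> W" "X = ?R `` {a}" "b \<in> W" "Y = ?R `` {b}" "pumps (f X) a" "pumps (f X) b"
      using f[OF XY(1)] f[OF XY(2)] XY(3) by metis
    then show "X = Y"
      using pumps_conj_rel equiv_class_eq[OF equiv_Restr_conj_rel[OF Nil_notin]] by auto
  qed
  moreover have N: "finite (nonterminals G)" "start G \<in> nonterminals G"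
    using cfg by (auto simp: is_cfg_def)
  ultimately have "card (W // ?R) \<le> card (nonterminals G - {start G})"
    using f by (intro card_inj_on_le[of f]) auto
  moreover have "card (nonterminals G) > 0"
    using N card_gt_0_iff by blast
  ultimately show ?thesis
    using N by (simp add: card_Diff_singleton)
qed

end

section \<open>The exact nonterminal complexity from both bounds\<close>

lemma Var_union_wstar:
  assumes "finite W" "[] \<notin> W" "w1 \<in> W" "w2 \<in> W" "w1 @ w2 \<noteq> w2 @ w1"
  shows "Var (\<Union>w\<in>W. wstar w) = Suc (card (W // Restr conj_rel W))"
  unfolding Var_def
proof (rule Least_equality)
  show "\<exists>G :: (nat, 'a) cfg. is_cfg G \<and> language G = (\<Union>w\<in>W. wstar w) \<and>
      card (nonterminals G) = Suc (card (W // Restr conj_rel W))"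
    using assms ex_cfg_conj_classes by blast
next
  fix k
  assume "\<exists>G :: (nat, 'a) cfg. is_cfg G \<and> language G = (\<Union>w\<in>W. wstar w) \<and> card (nonterminals G) = k"
  then show "Suc (card (W // Restr conj_rel W)) \<le> k"
    using assms union_wstar_cfg.Suc_card_classes_le[of _ W w1 w2] union_wstar_cfg.intro by metis
qed

theorem theorem3p3:
  fixes \<Sigma> :: "'a set" and w :: "nat \<Rightarrow> 'a list" and n k :: nat
  assumes "finite \<Sigma>"
    and "n \<ge> 1"
    and "\<And>i. i \<in> {1..n} \<Longrightarrow> w i \<in> lists \<Sigma>"
    and "\<And>i. i \<in> {1..n} \<Longrightarrow> w i \<noteq> []"
    and "inj_on w {1..n}"
    and "\<exists>i\<in>{1..n}. \<exists>j\<in>{1..n}. w i @ w j \<noteq> w j @ w i"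
    and "k > 1"
  shows "Var (\<Union>i\<in>{1..n}. wstar (w i)) = k \<longleftrightarrow>
    card (w ` {1..n} // Restr conj_rel (w ` {1..n})) = k - 1"
proof -
  obtain i j where ij: "i \<in> {1..n}" "j \<in> {1..n}" "w i @ w j \<noteq> w j @ w i"
    using assms(6) by blast
  have "[] \<notin> w ` {1..n}"
    using assms(4) by fastforce
  then have "Var (\<Union>x\<in>w ` {1..n}. wstar x) = Suc (card (w ` {1..n} // Restr conj_rel (w ` {1..n})))"
    using ij by (intro Var_union_wstar[of _ "w i" "w j"]) simp_all
  \<comment> \<open>As \<open>k > 1\<close>, the natural-number difference \<open>k - 1\<close> does
    not truncate, so it matches the \<open>Suc\<close> in the computed value.\<close>
  then show ?thesis
    using assms(7) by auto
qed

end
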